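(* Let $(\mathsf{C},\otimes,I)$ be a $\mathbb{Q}_{\ge 0}$-linear symmetric monoidal category. Let $(A_n)_{n\ge 0}\in\mathsf{C}^{\mathbb{N}}$, and let $(\nabla_{n,p}:A_n\otimes A_p\to A_{n+p})_{n,p\ge 0}$, $(\Delta_{n,p}:A_{n+p}\to A_n\otimes A_p)_{n,p\ge 0}$, $\eta:I\to A_0$ and $\epsilon:A_0\to I$ be maps in $\mathsf{C}$. The graded object $(A_n)$ together with these maps is a binomial bimonoid if and only if the following eight axioms hold for all $n,p,q,r\ge 0$: (1) $\eta\otimes\mathsf{id}_{A_n};\nabla_{0,n}=\mathsf{id}_{A_n}$; (2) $\mathsf{id}_{A_n}\otimes\eta;\nabla_{n,0}=\mathsf{id}_{A_n}$; (3) $\Delta_{0,n};\epsilon\otimes\mathsf{id}_{A_n}=\mathsf{id}_{A_n}$; (4) $\Delta_{n,0};\mathsf{id}_{A_n}\otimes\epsilon=\mathsf{id}_{A_n}$; (5) whenever $n+p=q+r$, $$\nabla_{n,p};\Delta_{q,r}=\sum_{\substack{a,b,c,d\ge 0\\ a+b=n,\ c+d=p\\ a+c=q,\ b+d=r}}\Delta_{a,b}\otimes\Delta_{c,d};\mathsf{id}_{A_a}\otimes\gamma_{A_b,A_c}\otimes\mathsf{id}_{A_d};\nabla_{a,c}\otimes\nabla_{b,d};$$ (6) $\eta;\epsilon=\mathsf{id}_I$; (7) $\Delta_{n,p};\nabla_{n,p}=\binom{n+p}{n}\mathsf{id}_{A_{n+p}}$; (8) $\epsilon;\eta=\mathsf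{id}_{A_0}$.
   Context: Conventions. $f;g$ denotes composition in diagrammatic order (first $f$, then $g$); $\otimes$ binds tighter than $;$. Symmetric monoidal categories are treated as strict (unitors and associators suppressed). $\gamma_{A,B}:A\otimes B\to B\otimes A$ is the symmetry. A $\mathbb{Q}_{\ge 0}$-linear symmetric monoidal category is a symmetric monoidal category in which every hom-set is a module over the commutative semiring $\mathbb{Q}_{\ge 0}$ (a commutative monoid with an action of $\mathbb{Q}_{\ge 0}$ satisfying the usual module axioms), and both composition and $\otimes$ of morphisms are $\mathbb{Q}_{\ge 0}$-bilinear (in particular preserve $0$ in each variable). A graded object is a family $(A_n)_{n\ge 0}\in\mathsf{C}^{\mathbb{N}}$. A binomial bimonoid is a graded object $(A_n)_{n\ge 0}$ with maps $\nabla_{n,p}:A_n\otimes A_p\to A_{n+p}$, $\Delta_{n,p}:A_{n+p}\to A_n\otimes A_p$ ($n,p\ge 0$), $\eta:I\to A_0$, $\epsilon:A_0\to I$ such that, for all $n,p,q,r\ge 0$: (i) unitality $\eta\otimes\mathsf{id}_{A_n};\nabla_{0,n}=\mathsf{id}_{A_n}$; (ii) associativity $\nabla_{n,p}\otimes\mathsf{id}_{A_q};\nabla_{n+p,q}=\mathsf{id}_{A_n}\otimes\nabla_{p,q};\nabla_{n,p+q}$; (iii) commutativity $\gamma_{A_n,A_p};\nabla_{p,n}=\nabla_{n,p}$; (iv) counitality $\Delta_{0,n};\epsilon\otimes\mathsf{id}_{A_n}=\mathsf{id}_{A_n}$; (v) coassociativity $\Delta_{n+p,q};\Delta_{n,p}\otimes\mathsf{id}_{A_q}=\Delta_{n,p+q};\mathsf{id}_{A_n}\otimes\Delta_{p,q}$;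 (vi) cocommutativity $\Delta_{n,p};\gamma_{A_n,A_p}=\Delta_{p,n}$; (vii) $\nabla_{0,0};\epsilon=\epsilon\otimes\epsilon$; (viii) $\eta;\Delta_{0,0}=\eta\otimes\eta$; (ix) $\eta;\epsilon=\mathsf{id}_I$; (x) whenever $n+p=q+r$, $\nabla_{n,p};\Delta_{q,r}=\sum \Delta_{a,b}\otimes\Delta_{c,d};\mathsf{id}_{A_a}\otimes\gamma_{A_b,A_c}\otimes\mathsf{id}_{A_d};\nabla_{a,c}\otimes\nabla_{b,d}$, the sum being over all $a,b,c,d\ge 0$ with $a+b=n$, $c+d=p$, $a+c=q$, $b+d=r$; (xi) $\epsilon;\eta=\mathsf{id}_{A_0}$; (xii) $\Delta_{n,p};\nabla_{n,p}=\binom{n+p}{n}\mathsf{id}_{A_{n+p}}$. *)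

theory Defs
  imports "HOL.Rat" "HOL-Algebra.FiniteProduct"
begin

text \<open>
  Categories are given by a set of objects and a family of pairwise disjoint hom-sets.
  Composition is written in diagrammatic order. All operations are total HOL functions;
  they are only constrained on objects in \<open>Obj\<close> and on morphisms of matching types.
\<close>

record ('o, 'm) category =
  Obj :: "'o set"
  Hom :: "'o \<Rightarrow> 'o \<Rightarrow> 'm set"
  Ident :: "'o \<Rightarrow> 'm"  (\<open>\<i>\<d>\<index>\<close>)
  Comp :: "'m \<Rightarrow> 'm \<Rightarrow> 'm"  (infixl \<open>;;\<index>\<close> 55)

record ('o, 'm) smc = "('o, 'm) category" +
  Unit :: "'o"  (\<open>\<I>\<index>\<close>)
  TensorO :: "'o \<Rightarrow> 'o \<Rightarrow> 'o"  (infixl \<open>\<otimes>\<^sub>o\<index>\<close> 70)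
  TensorM :: "'m \<Rightarrow> 'm \<Rightarrow> 'm"  (infixl \<open>\<otimes>\<^sub>m\<index>\<close> 70)
  Symm :: "'o \<Rightarrow> 'o \<Rightarrow> 'm"  (\<open>\<gamma>\<index>\<close>)

record ('o, 'm) linear_smc = "('o, 'm) smc" +
  Zero :: "'o \<Rightarrow> 'o \<Rightarrow> 'm"
  Plus :: "'m \<Rightarrow> 'm \<Rightarrow> 'm"  (infixl \<open>+\<^sub>m\<index>\<close> 65)
  Scale :: "rat \<Rightarrow> 'm \<Rightarrow> 'm"  (infixr \<open>*\<^sub>m\<index>\<close> 75)

locale category =
  fixes C :: "('o, 'm, 'x) category_scheme" (structure)
  assumes Hom_disjoint:
      "\<lbrakk>a \<in> Obj C; b \<in> Obj C; a' \<in> Obj C; b' \<in> Obj C; f \<in> Hom C a b; f \<in> Hom C a' b'\<rbrakk>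
        \<Longrightarrow> a = a' \<and> b = b'"
    and Ident_in_Hom: "a \<in> Obj C \<Longrightarrow> \<i>\<d> a \<in> Hom C a a"
    and Comp_in_Hom:
      "\<lbrakk>a \<in> Obj C; b \<in> Obj C; c \<in> Obj C; f \<in> Hom C a b; g \<in> Hom C b c\<rbrakk> \<Longrightarrow> f ;; g \<in> Hom C a c"
    and Comp_Ident_left: "\<lbrakk>a \<in> Obj C; b \<in> Obj C; f \<in> Hom C a b\<rbrakk> \<Longrightarrow> \<i>\<d> a ;; f = f"
    and Comp_Ident_right: "\<lbrakk>a \<in> Obj C; b \<in> Obj C; f \<in> Hom C a b\<rbrakk> \<Longrightarrow> f ;; \<i>\<d> b = f"
    and Comp_assoc:
      "\<lbrakk>a \<in> Obj C; b \<in> Obj C; c \<in> Obj C; d \<in> Obj C;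
        f \<in> Hom C a b; g \<in> Hom C b c; h \<in> Hom C c d\<rbrakk> \<Longrightarrow> (f ;; g) ;; h = f ;; (g ;; h)"

locale strict_monoidal_category = category C
  for C :: "('o, 'm, 'x) smc_scheme" (structure) +
  assumes Unit_in_Obj: "\<I> \<in> Obj C"
    and TensorO_in_Obj: "\<lbrakk>a \<in> Obj C; b \<in> Obj C\<rbrakk> \<Longrightarrow> a \<otimes>\<^sub>o b \<in> Obj C"
    and TensorM_in_Hom:
      "\<lbrakk>a \<in> Obj C; b \<in> Obj C; a' \<in> Obj C; b' \<in> Obj C; f \<in> Hom C a b; g \<in> Hom C a' b'\<rbrakk>
        \<Longrightarrow> f \<otimes>\<^sub>m g \<in> Hom C (a \<otimes>\<^sub>o a') (b \<otimes>\<^sub>o b')"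
    and TensorM_Ident: "\<lbrakk>a \<in> Obj C; b \<in> Obj C\<rbrakk> \<Longrightarrow> \<i>\<d> a \<otimes>\<^sub>m \<i>\<d> b = \<i>\<d> (a \<otimes>\<^sub>o b)"
    and TensorM_Comp:
      "\<lbrakk>a \<in> Obj C; b \<in> Obj C; c \<in> Obj C; a' \<in> Obj C; b' \<in> Obj C; c' \<in> Obj C;
        f \<in> Hom C a b; g \<in> Hom C b c; f' \<in> Hom C a' b'; g' \<in> Hom C b' c'\<rbrakk>
        \<Longrightarrow> (f ;; g) \<otimes>\<^sub>m (f' ;; g') = (f \<otimes>\<^sub>m f') ;; (g \<otimes>\<^sub>m g')"
    and TensorO_assoc:
      "\<lbrakk>a \<in> Obj C; b \<in> Obj C; c \<in> Obj C\<rbrakk> \<Longrightarrow> (a \<otimes>\<^sub>o b) \<otimes>\<^sub>o c = a \<otimes>\<^sub>o (b \<otimes>\<^sub>o c)"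
    and TensorO_Unit_left: "a \<in> Obj C \<Longrightarrow> \<I> \<otimes>\<^sub>o a = a"
    and TensorO_Unit_right: "a \<in> Obj C \<Longrightarrow> a \<otimes>\<^sub>o \<I> = a"
    and TensorM_assoc:
      "\<lbrakk>a \<in> Obj C; b \<in> Obj C; a' \<in> Obj C; b' \<in> Obj C; a'' \<in> Obj C; b'' \<in> Obj C;
        f \<in> Hom C a b; g \<in> Hom C a' b'; h \<in> Hom C a'' b''\<rbrakk>
        \<Longrightarrow> (f \<otimes>\<^sub>m g) \<otimes>\<^sub>m h = f \<otimes>\<^sub>m (g \<otimes>\<^sub>m h)"
    and TensorM_Unit_left: "\<lbrakk>a \<in> Obj C; b \<in> Obj C; f \<in> Hom C a b\<rbrakk> \<Longrightarrow> \<i>\<d> \<I> \<otimes>\<^sub>m f = f"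
    and TensorM_Unit_right: "\<lbrakk>a \<in> Obj C; b \<in> Obj C; f \<in> Hom C a b\<rbrakk> \<Longrightarrow> f \<otimes>\<^sub>m \<i>\<d> \<I> = f"

text \<open>
  The unit coherence \<open>\<gamma> a \<I> = \<i>\<d> a\<close> is not listed below: it follows from the hexagon
  and the invertibility of the symmetry.
\<close>

locale strict_symmetric_monoidal_category = strict_monoidal_category C
  for C :: "('o, 'm, 'x) smc_scheme" (structure) +
  assumes Symm_in_Hom:
      "\<lbrakk>a \<in> Obj C; b \<in> Obj C\<rbrakk> \<Longrightarrow> \<gamma> a b \<in> Hom C (a \<otimes>\<^sub>o b) (b \<otimes>\<^sub>o a)"
    and Symm_natural:
      "\<lbrakk>a \<in> Obj C; b \<in> Obj C; a' \<in> Obj C; b' \<in> Obj C; f \<in> Hom C a a'; g \<in> Hom C b b'\<rbrakk>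
        \<Longrightarrow> f \<otimes>\<^sub>m g ;; \<gamma> a' b' = \<gamma> a b ;; g \<otimes>\<^sub>m f"
    and Symm_Symm: "\<lbrakk>a \<in> Obj C; b \<in> Obj C\<rbrakk> \<Longrightarrow> \<gamma> a b ;; \<gamma> b a = \<i>\<d> (a \<otimes>\<^sub>o b)"
    and Symm_hexagon:
      "\<lbrakk>a \<in> Obj C; b \<in> Obj C; c \<in> Obj C\<rbrakk>
        \<Longrightarrow> \<gamma> a (b \<otimes>\<^sub>o c) = \<gamma> a b \<otimes>\<^sub>m \<i>\<d> c ;; \<i>\<d> b \<otimes>\<^sub>m \<gamma> a c"

text \<open>
  The additive monoid of a hom-set in the multiplicative vocabulary of \<open>monoid\<close>;
  \<open>finprod\<close> over it is therefore the finite sum of morphisms.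
\<close>

definition hom_monoid :: "('o, 'm, 'x) linear_smc_scheme \<Rightarrow> 'o \<Rightarrow> 'o \<Rightarrow> 'm monoid" where
  "hom_monoid C a b = \<lparr>carrier = Hom C a b, monoid.mult = Plus C, one = Zero C a b\<rparr>"

text \<open>
  Scalars are the nonnegative rationals: \<open>Scale\<close> takes a \<open>rat\<close>, but nothing is
  assumed about negative arguments.
\<close>

locale Qge0_linear_symmetric_monoidal_category = strict_symmetric_monoidal_category C
  for C :: "('o, 'm, 'x) linear_smc_scheme" (structure) +
  assumes Hom_comm_monoid: "\<lbrakk>a \<in> Obj C; b \<in> Obj C\<rbrakk> \<Longrightarrow> comm_monoid (hom_monoid C a b)"
    and Scale_in_Hom:
      "\<lbrakk>a \<in> Obj C; b \<in> Obj C; 0 \<le> s; f \<in> Hom C a b\<rbrakk> \<Longrightarrow> s *\<^sub>m f \<in> Hom C a b"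
    and Scale_Plus:
      "\<lbrakk>a \<in> Obj C; b \<in> Obj C; 0 \<le> s; f \<in> Hom C a b; g \<in> Hom C a b\<rbrakk>
        \<Longrightarrow> s *\<^sub>m (f +\<^sub>m g) = s *\<^sub>m f +\<^sub>m s *\<^sub>m g"
    and Scale_Zero: "\<lbrakk>a \<in> Obj C; b \<in> Obj C; 0 \<le> s\<rbrakk> \<Longrightarrow> s *\<^sub>m Zero C a b = Zero C a b"
    and Scale_add:
      "\<lbrakk>a \<in> Obj C; b \<in> Obj C; 0 \<le> s; 0 \<le> t; f \<in> Hom C a b\<rbrakk>
        \<Longrightarrow> (s + t) *\<^sub>m f = s *\<^sub>m f +\<^sub>m t *\<^sub>m f"
    and Scale_zero: "\<lbrakk>a \<in> Obj C; b \<in> Obj C; f \<in> Hom C a b\<rbrakk> \<Longrightarrow> 0 *\<^sub>m f = Zero C a b"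
    and Scale_mult:
      "\<lbrakk>a \<in> Obj C; b \<in> Obj C; 0 \<le> s; 0 \<le> t; f \<in> Hom C a b\<rbrakk>
        \<Longrightarrow> (s * t) *\<^sub>m f = s *\<^sub>m (t *\<^sub>m f)"
    and Scale_one: "\<lbrakk>a \<in> Obj C; b \<in> Obj C; f \<in> Hom C a b\<rbrakk> \<Longrightarrow> 1 *\<^sub>m f = f"
    and Comp_Plus_left:
      "\<lbrakk>a \<in> Obj C; b \<in> Obj C; c \<in> Obj C; f \<in> Hom C a b; f' \<in> Hom C a b; g \<in> Hom C b c\<rbrakk>
        \<Longrightarrow> (f +\<^sub>m f') ;; g = (f ;; g) +\<^sub>m (f' ;; g)"
    and Comp_Plus_right:
      "\<lbrakk>a \<in> Obj C; b \<in> Obj C; c \<in> Obj C; f \<in> Hom C a b; g \<in> Hom C b c; g' \<in> Hom C b c\<rbrakk>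
        \<Longrightarrow> f ;; (g +\<^sub>m g') = (f ;; g) +\<^sub>m (f ;; g')"
    and Comp_Zero_left:
      "\<lbrakk>a \<in> Obj C; b \<in> Obj C; c \<in> Obj C; g \<in> Hom C b c\<rbrakk> \<Longrightarrow> Zero C a b ;; g = Zero C a c"
    and Comp_Zero_right:
      "\<lbrakk>a \<in> Obj C; b \<in> Obj C; c \<in> Obj C; f \<in> Hom C a b\<rbrakk> \<Longrightarrow> f ;; Zero C b c = Zero C a c"
    and Comp_Scale_left:
      "\<lbrakk>a \<in> Obj C; b \<in> Obj C; c \<in> Obj C; 0 \<le> s; f \<in> Hom C a b; g \<in> Hom C b c\<rbrakk>
        \<Longrightarrow> s *\<^sub>m f ;; g = s *\<^sub>m (f ;; g)"
    and Comp_Scale_right: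
      "\<lbrakk>a \<in> Obj C; b \<in> Obj C; c \<in> Obj C; 0 \<le> s; f \<in> Hom C a b; g \<in> Hom C b c\<rbrakk>
        \<Longrightarrow> f ;; s *\<^sub>m g = s *\<^sub>m (f ;; g)"
    and TensorM_Plus_left:
      "\<lbrakk>a \<in> Obj C; b \<in> Obj C; c \<in> Obj C; d \<in> Obj C;
        f \<in> Hom C a b; f' \<in> Hom C a b; g \<in> Hom C c d\<rbrakk>
        \<Longrightarrow> (f +\<^sub>m f') \<otimes>\<^sub>m g = f \<otimes>\<^sub>m g +\<^sub>m f' \<otimes>\<^sub>m g"
    and TensorM_Plus_right:
      "\<lbrakk>a \<in> Obj C; b \<in> Obj C; c \<in> Obj C; d \<in> Obj C;
        f \<in> Hom C a b; g \<in> Hom C c d; g' \<in> Hom C c d\<rbrakk>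
        \<Longrightarrow> f \<otimes>\<^sub>m (g +\<^sub>m g') = f \<otimes>\<^sub>m g +\<^sub>m f \<otimes>\<^sub>m g'"
    and TensorM_Zero_left:
      "\<lbrakk>a \<in> Obj C; b \<in> Obj C; c \<in> Obj C; d \<in> Obj C; g \<in> Hom C c d\<rbrakk>
        \<Longrightarrow> Zero C a b \<otimes>\<^sub>m g = Zero C (a \<otimes>\<^sub>o c) (b \<otimes>\<^sub>o d)"
    and TensorM_Zero_right:
      "\<lbrakk>a \<in> Obj C; b \<in> Obj C; c \<in> Obj C; d \<in> Obj C; f \<in> Hom C a b\<rbrakk>
        \<Longrightarrow> f \<otimes>\<^sub>m Zero C c d = Zero C (a \<otimes>\<^sub>o c) (b \<otimes>\<^sub>o d)"
    and TensorM_Scale_left: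
      "\<lbrakk>a \<in> Obj C; b \<in> Obj C; c \<in> Obj C; d \<in> Obj C; 0 \<le> s; f \<in> Hom C a b; g \<in> Hom C c d\<rbrakk>
        \<Longrightarrow> (s *\<^sub>m f) \<otimes>\<^sub>m g = s *\<^sub>m (f \<otimes>\<^sub>m g)"
    and TensorM_Scale_right:
      "\<lbrakk>a \<in> Obj C; b \<in> Obj C; c \<in> Obj C; d \<in> Obj C; 0 \<le> s; f \<in> Hom C a b; g \<in> Hom C c d\<rbrakk>
        \<Longrightarrow> f \<otimes>\<^sub>m (s *\<^sub>m g) = s *\<^sub>m (f \<otimes>\<^sub>m g)"

locale binomial_bimonoid = Qge0_linear_symmetric_monoidal_category C
  for C :: "('o, 'm, 'x) linear_smc_scheme" (structure) +
  fixes A :: "nat \<Rightarrow> 'o"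
    and nabla :: "nat \<Rightarrow> nat \<Rightarrow> 'm"  (\<open>\<nabla>\<close>)
    and Delta :: "nat \<Rightarrow> nat \<Rightarrow> 'm"  (\<open>\<Delta>\<close>)
    and eta :: 'm  (\<open>\<eta>\<close>)
    and eps :: 'm  (\<open>\<epsilon>\<close>)
  assumes A_in_Obj: "A n \<in> Obj C"
    and nabla_in_Hom: "\<nabla> n p \<in> Hom C (A n \<otimes>\<^sub>o A p) (A (n + p))"
    and Delta_in_Hom: "\<Delta> n p \<in> Hom C (A (n + p)) (A n \<otimes>\<^sub>o A p)"
    and eta_in_Hom: "\<eta> \<in> Hom C \<I> (A 0)"
    and eps_in_Hom: "\<epsilon> \<in> Hom C (A 0) \<I>"
    and unital: "\<eta> \<otimes>\<^sub>m \<i>\<d> (A n) ;; \<nabla> 0 n = \<i>\<d> (A n)"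
    and assoc:
      "\<nabla> n p \<otimes>\<^sub>m \<i>\<d> (A q) ;; \<nabla> (n + p) q = \<i>\<d> (A n) \<otimes>\<^sub>m \<nabla> p q ;; \<nabla> n (p + q)"
    and comm: "\<gamma> (A n) (A p) ;; \<nabla> p n = \<nabla> n p"
    and counital: "\<Delta> 0 n ;; \<epsilon> \<otimes>\<^sub>m \<i>\<d> (A n) = \<i>\<d> (A n)"
    and coassoc:
      "\<Delta> (n + p) q ;; \<Delta> n p \<otimes>\<^sub>m \<i>\<d> (A q) = \<Delta> n (p + q) ;; \<i>\<d> (A n) \<otimes>\<^sub>m \<Delta> p q"
    and cocomm: "\<Delta> n p ;; \<gamma> (A n) (A p) = \<Delta> p n"
    and nabla_eps: "\<nabla> 0 0 ;; \<epsilon> = \<epsilon> \<otimes>\<^sub>m \<epsilon>"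
    and eta_Delta: "\<eta> ;; \<Delta> 0 0 = \<eta> \<otimes>\<^sub>m \<eta>"
    and eta_eps: "\<eta> ;; \<epsilon> = \<i>\<d> \<I>"
    and nabla_Delta:
      "n + p = q + r \<Longrightarrow>
        \<nabla> n p ;; \<Delta> q r =
          finprod (hom_monoid C (A n \<otimes>\<^sub>o A p) (A q \<otimes>\<^sub>o A r))
            (\<lambda>(a, b, c, d). \<Delta> a b \<otimes>\<^sub>m \<Delta> c d
              ;; \<i>\<d> (A a) \<otimes>\<^sub>m \<gamma> (A b) (A c) \<otimes>\<^sub>m \<i>\<d> (A d)
              ;; \<nabla> a c \<otimes>\<^sub>m \<nabla> b d)
            {(a, b, c, d). a + b = n \<and> c + d = p \<and> a + c = q \<and> b + d = r}"
    and eps_eta: "\<epsilon> ;; \<eta> = \<i>\<d> (A 0)"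
    and Delta_nabla:
      "\<Delta> n p ;; \<nabla> n p = of_nat ((n + p) choose n) *\<^sub>m \<i>\<d> (A (n + p))"

end

theory Submission imports Defs
begin

text \<open>
  Since \<open>\<epsilon>\<close> and \<open>\<eta>\<close> are mutually inverse, the (co)unit laws force \<open>\<nabla> 0 n = \<epsilon> \<otimes>\<^sub>m \<i>\<d>\<close> and
  \<open>\<Delta> 0 n = \<eta> \<otimes>\<^sub>m \<i>\<d>\<close>, so that law (5) with \<open>q = 1\<close> becomes a two-term Leibniz rule for
  \<open>\<Delta> 1 _\<close>. Because \<open>\<Delta> 1 n ;; \<nabla> 1 n = (n + 1) *\<^sub>m \<i>\<d>\<close> and \<open>n + 1\<close> is an invertible scalar,
  maps into \<open>A (n + 1)\<close> may be compared after composing with \<open>\<Delta> 1 n\<close>. Commutativity and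
  associativity follow by induction on the total degree: the Leibniz rule reduces both sides
  to the same summands in lower degree. Cocommutativity and coassociativity are the same
  statements in the opposite category, where \<open>\<nabla>\<close> and \<open>\<Delta>\<close> exchange their roles.
\<close>

text \<open>
  Source and target as total functions turn the typing conditions of all equations below into
  side conditions that the simplifier discharges. They are arbitrary when \<open>arr f\<close> fails.
\<close>

context category
begin

definition arr :: "'m \<Rightarrow> bool" where
  "arr f \<longleftrightarrow> (\<exists>a\<in>Obj C. \<exists>b\<in>Obj C. f \<in> Hom C a b)"

definition src :: "'m \<Rightarrow> 'o" where
  "src f = (SOME a. a \<in> Obj C \<and> (\<exists>b\<in>Obj C. f \<in> Hom C a b))"

definition tgt :: "'m \<Rightarrow> 'o" where
  "tgt f = (SOME b. b \<in> Obj C \<and> (\<exists>a\<in>Obj C. f \<in> Hom C a b))"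

text \<open>Disjointness of the hom-sets leaves one candidate for each endpoint, so the choices in
  \<open>src\<close> and \<open>tgt\<close> are forced.\<close>

lemma Hom_D:
  assumes "f \<in> Hom C a b" "a \<in> Obj C" "b \<in> Obj C"
  shows "arr f" "src f = a" "tgt f = b"
proof -
  show "arr f" using assms unfolding arr_def by blast
  show "src f = a" unfolding src_def by (rule some_equality) (use assms Hom_disjoint in blast)+
  show "tgt f = b" unfolding tgt_def by (rule some_equality) (use assms Hom_disjoint in blast)+
qed

lemma arr_D:
  assumes "arr f"
  shows "f \<in> Hom C (src f) (tgt f)" "src f \<in> Obj C" "tgt f \<in> Obj C"
proof -
  obtain a b where *: "f \<in> Hom C a b" "a \<in> Obj C" "b \<in> Obj C"
    using assms unfolding arr_def by blast
  note ** = Hom_D(2,3)[OF *]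
  show "f \<in> Hom C (src f) (tgt f)" "src f \<in> Obj C" "tgt f \<in> Obj C" using * ** by simp_all
qed

lemma Hom_iff: "\<lbrakk>a \<in> Obj C; b \<in> Obj C\<rbrakk> \<Longrightarrow> f \<in> Hom C a b \<longleftrightarrow> arr f \<and> src f = a \<and> tgt f = b"
  using Hom_D arr_D by blast

declare arr_D(2,3) [simp]

lemma ident_simps [simp]:
  "a \<in> Obj C \<Longrightarrow> arr (\<i>\<d> a)" "a \<in> Obj C \<Longrightarrow> src (\<i>\<d> a) = a" "a \<in> Obj C \<Longrightarrow> tgt (\<i>\<d> a) = a"
  using Hom_D[OF Ident_in_Hom] by blast+

lemma comp_simps [simp]:
  assumes "arr f" "arr g" "tgt f = src g"
  shows "arr (f ;; g)" "src (f ;; g) = src f" "tgt (f ;; g) = tgt g"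
  using Hom_D[OF Comp_in_Hom[of "src f" "tgt f" "tgt g" f g]] arr_D[OF assms(1)] arr_D[OF assms(2)]
    assms(3) by simp_all

lemma comp_ident_left [simp]: "\<lbrakk>arr f; src f = a\<rbrakk> \<Longrightarrow> \<i>\<d> a ;; f = f"
  using Comp_Ident_left arr_D by blast

lemma comp_ident_right [simp]: "\<lbrakk>arr f; tgt f = a\<rbrakk> \<Longrightarrow> f ;; \<i>\<d> a = f"
  using Comp_Ident_right arr_D by blast

lemma comp_assoc [simp]:
  assumes "arr f" "arr g" "arr h" "tgt f = src g" "tgt g = src h"
  shows "(f ;; g) ;; h = f ;; (g ;; h)"
  using Comp_assoc[of "src f" "tgt f" "tgt g" "tgt h" f g h] arr_D[OF assms(1)]
    arr_D[OF assms(2)] arr_D[OF assms(3)] assms(4,5) by simp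

end

section \<open>Typing and interchange in strict monoidal categories\<close>

context strict_monoidal_category
begin

declare Unit_in_Obj [simp] TensorO_in_Obj [simp] TensorO_assoc [simp]
  TensorO_Unit_left [simp] TensorO_Unit_right [simp] TensorM_Ident [simp]

lemma tensor_simps [simp]:
  assumes "arr f" "arr g"
  shows "arr (f \<otimes>\<^sub>m g)" "src (f \<otimes>\<^sub>m g) = src f \<otimes>\<^sub>o src g" "tgt (f \<otimes>\<^sub>m g) = tgt f \<otimes>\<^sub>o tgt g"
  using Hom_D[OF TensorM_in_Hom[of "src f" "tgt f" "src g" "tgt g" f g]]
    arr_D[OF assms(1)] arr_D[OF assms(2)] by simp_all

lemma tensor_assoc [simp]:
  "\<lbrakk>arr f; arr g; arr h\<rbrakk> \<Longrightarrow> (f \<otimes>\<^sub>m g) \<otimes>\<^sub>m h = f \<otimes>\<^sub>m (g \<otimes>\<^sub>m h)"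
  by (rule TensorM_assoc[of "src f" "tgt f" "src g" "tgt g" "src h" "tgt h"]) (simp_all add: Hom_iff)

lemma tensor_unit [simp]: "arr f \<Longrightarrow> \<i>\<d> \<I> \<otimes>\<^sub>m f = f" "arr f \<Longrightarrow> f \<otimes>\<^sub>m \<i>\<d> \<I> = f"
  using TensorM_Unit_left[of "src f" "tgt f" f] TensorM_Unit_right[of "src f" "tgt f" f]
  by (simp_all add: Hom_iff)

lemma tensor_ident_ident: "\<lbrakk>a \<in> Obj C; b \<in> Obj C; arr f\<rbrakk> \<Longrightarrow> \<i>\<d> a \<otimes>\<^sub>m (\<i>\<d> b \<otimes>\<^sub>m f) = \<i>\<d> (a \<otimes>\<^sub>o b) \<otimes>\<^sub>m f"
  by (simp flip: tensor_assoc)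

lemma interchange:
  assumes "arr f" "arr g" "arr f'" "arr g'" "tgt f = src g" "tgt f' = src g'"
  shows "f \<otimes>\<^sub>m f' ;; g \<otimes>\<^sub>m g' = (f ;; g) \<otimes>\<^sub>m (f' ;; g')"
  using TensorM_Comp[of "src f" "tgt f" "tgt g" "src f'" "tgt f'" "tgt g'" f g f' g']
    arr_D[OF assms(1)] arr_D[OF assms(2)] arr_D[OF assms(3)] arr_D[OF assms(4)] assms(5,6)
  by simp

text \<open>This rule and the next run against \<open>interchange\<close>: they push an identity
  factor into a composite, so that single layers can be moved.\<close>

lemma tensor_comp_ident:
  "\<lbrakk>arr f; arr g; tgt f = src g; a \<in> Obj C\<rbrakk> \<Longrightarrow> (f ;; g) \<otimes>\<^sub>m \<i>\<d> a = f \<otimes>\<^sub>m \<i>\<d> a ;; g \<otimes>\<^sub>m \<i>\<d> a"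
  by (simp add: interchange)

lemma tensor_ident_comp:
  "\<lbrakk>arr f; arr g; tgt f = src g; a \<in> Obj C\<rbrakk> \<Longrightarrow> \<i>\<d> a \<otimes>\<^sub>m (f ;; g) = \<i>\<d> a \<otimes>\<^sub>m f ;; \<i>\<d> a \<otimes>\<^sub>m g"
  by (simp add: interchange)

text \<open>Morphisms on different tensor factors commute, since both composites equal
  \<open>f \<otimes>\<^sub>m g\<close>.\<close>

lemma slide:
  "\<lbrakk>arr f; arr g\<rbrakk>
    \<Longrightarrow> f \<otimes>\<^sub>m \<i>\<d> (src g) ;; \<i>\<d> (tgt f) \<otimes>\<^sub>m g = \<i>\<d> (src f) \<otimes>\<^sub>m g ;; f \<otimes>\<^sub>m \<i>\<d> (tgt g)"
  by (simp add: interchange)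

end

section \<open>Naturality, hexagons and unit coherence of the symmetry\<close>

context strict_symmetric_monoidal_category
begin

lemma symm_simps [simp]:
  assumes "a \<in> Obj C" "b \<in> Obj C"
  shows "arr (\<gamma> a b)" "src (\<gamma> a b) = a \<otimes>\<^sub>o b" "tgt (\<gamma> a b) = b \<otimes>\<^sub>o a"
  using Hom_D[OF Symm_in_Hom[OF assms]] assms by simp_all

lemma symm_natural:
  "\<lbrakk>arr f; arr g\<rbrakk> \<Longrightarrow> f \<otimes>\<^sub>m g ;; \<gamma> (tgt f) (tgt g) = \<gamma> (src f) (src g) ;; g \<otimes>\<^sub>m f"
  by (rule Symm_natural) (auto dest: arr_D)

text \<open>The right-hand side followed by \<open>\<gamma> c (a \<otimes>\<^sub>o b)\<close> is an
  identity: the hexagon splits the latter, and the crossings cancel in pairs. This form is the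
  hexagon of the opposite category.\<close>

lemma Symm_hexagon_left:
  assumes [simp]: "a \<in> Obj C" "b \<in> Obj C" "c \<in> Obj C"
  shows "\<gamma> (a \<otimes>\<^sub>o b) c = \<i>\<d> a \<otimes>\<^sub>m \<gamma> b c ;; \<gamma> a c \<otimes>\<^sub>m \<i>\<d> b"
proof -
  let ?f = "\<i>\<d> a \<otimes>\<^sub>m \<gamma> b c ;; \<gamma> a c \<otimes>\<^sub>m \<i>\<d> b"
  have "?f ;; \<gamma> c (a \<otimes>\<^sub>o b)
      = \<i>\<d> a \<otimes>\<^sub>m \<gamma> b c ;; ((\<gamma> a c \<otimes>\<^sub>m \<i>\<d> b ;; \<gamma> c a \<otimes>\<^sub>m \<i>\<d> b) ;; \<i>\<d> a \<otimes>\<^sub>m \<gamma> c b)"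
    by (simp add: Symm_hexagon)
  also have "\<gamma> a c \<otimes>\<^sub>m \<i>\<d> b ;; \<gamma> c a \<otimes>\<^sub>m \<i>\<d> b = \<i>\<d> (a \<otimes>\<^sub>o c \<otimes>\<^sub>o b)"
    by (simp add: interchange Symm_Symm)
  also have "\<i>\<d> a \<otimes>\<^sub>m \<gamma> b c ;; (\<i>\<d> (a \<otimes>\<^sub>o c \<otimes>\<^sub>o b) ;; \<i>\<d> a \<otimes>\<^sub>m \<gamma> c b) = \<i>\<d> (a \<otimes>\<^sub>o b \<otimes>\<^sub>o c)"
    by (simp add: interchange Symm_Symm)
  finally have *: "?f ;; \<gamma> c (a \<otimes>\<^sub>o b) = \<i>\<d> (a \<otimes>\<^sub>o b \<otimes>\<^sub>o c)" .
  have "?f = ?f ;; (\<gamma> c (a \<otimes>\<^sub>o b) ;; \<gamma> (a \<otimes>\<^sub>o b) c)"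
    by (subst Symm_Symm) simp_all
  also have "\<dots> = (?f ;; \<gamma> c (a \<otimes>\<^sub>o b)) ;; \<gamma> (a \<otimes>\<^sub>o b) c"
    by (simp del: TensorO_assoc add: TensorO_assoc[symmetric])
  also have "\<dots> = \<gamma> (a \<otimes>\<^sub>o b) c"
    unfolding * by simp
  finally show ?thesis by simp
qed

text \<open>The hexagon with \<open>\<I>\<close> for both other objects makes
  \<open>\<gamma> a \<I>\<close> idempotent, and an invertible idempotent is an identity.\<close>

lemma Symm_Unit_right [simp]:
  assumes [simp]: "a \<in> Obj C"
  shows "\<gamma> a \<I> = \<i>\<d> a"
proof -
  have idem: "\<gamma> a \<I> ;; \<gamma> a \<I> = \<gamma> a \<I>"
    using Symm_hexagon[of a \<I> \<I>] by simp
  have "\<gamma> a \<I> = \<gamma> a \<I> ;; (\<gamma> a \<I> ;; \<gamma> \<I> a)"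
    by (subst Symm_Symm) simp_all
  also have "\<dots> = (\<gamma> a \<I> ;; \<gamma> a \<I>) ;; \<gamma> \<I> a"
    by simp
  also have "\<dots> = \<i>\<d> a"
    unfolding idem by (simp add: Symm_Symm)
  finally show ?thesis .
qed

lemma Symm_Unit_left [simp]: "a \<in> Obj C \<Longrightarrow> \<gamma> \<I> a = \<i>\<d> a"
  using Symm_Symm[of a \<I>] by simp

end

section \<open>Sums and scalars on hom-sets\<close>

context Qge0_linear_symmetric_monoidal_category
begin

lemma plus_simps [simp]:
  assumes "arr f" "arr g" "src g = src f" "tgt g = tgt f"
  shows "arr (f +\<^sub>m g)" "src (f +\<^sub>m g) = src f" "tgt (f +\<^sub>m g) = tgt f"
proof -
  interpret H: comm_monoid "hom_monoid C (src f) (tgt f)"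
    using assms by (intro Hom_comm_monoid) simp_all
  have "f +\<^sub>m g \<in> Hom C (src f) (tgt f)"
    using H.m_closed[of f g] arr_D(1)[OF assms(1)] arr_D(1)[OF assms(2)] assms(3,4)
    by (simp add: hom_monoid_def)
  with assms(1) show "arr (f +\<^sub>m g)" "src (f +\<^sub>m g) = src f" "tgt (f +\<^sub>m g) = tgt f"
    by (auto simp: Hom_iff)
qed

lemma plus_commute:
  assumes "arr f" "arr g" "src g = src f" "tgt g = tgt f"
  shows "f +\<^sub>m g = g +\<^sub>m f"
proof -
  interpret H: comm_monoid "hom_monoid C (src f) (tgt f)"
    using assms by (intro Hom_comm_monoid) simp_all
  show ?thesis
    using H.m_comm[of f g] arr_D(1)[OF assms(1)] arr_D(1)[OF assms(2)] assms(3,4)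
    by (simp add: hom_monoid_def)
qed

lemma plus_assoc:
  assumes "arr f" "arr g" "arr h" "src g = src f" "tgt g = tgt f" "src h = src f" "tgt h = tgt f"
  shows "(f +\<^sub>m g) +\<^sub>m h = f +\<^sub>m (g +\<^sub>m h)"
proof -
  interpret H: comm_monoid "hom_monoid C (src f) (tgt f)"
    using assms by (intro Hom_comm_monoid) simp_all
  show ?thesis
    using H.m_assoc[of f g h] arr_D(1)[OF assms(1)] arr_D(1)[OF assms(2)] arr_D(1)[OF assms(3)]
      assms(4-)
    by (simp add: hom_monoid_def)
qed

lemma comp_plus_left:
  "\<lbrakk>arr f; arr f'; arr g; src f' = src f; tgt f' = tgt f; tgt f = src g\<rbrakk>
    \<Longrightarrow> (f +\<^sub>m f') ;; g = (f ;; g) +\<^sub>m (f' ;; g)"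
  by (rule Comp_Plus_left[of "src f" "src g" "tgt g"]) (simp_all add: Hom_iff)

lemma comp_plus_right:
  "\<lbrakk>arr f; arr g; arr g'; src g' = src g; tgt g' = tgt g; tgt f = src g\<rbrakk>
    \<Longrightarrow> f ;; (g +\<^sub>m g') = (f ;; g) +\<^sub>m (f ;; g')"
  by (rule Comp_Plus_right[of "src f" "src g" "tgt g"]) (simp_all add: Hom_iff)

lemma tensor_plus_left:
  "\<lbrakk>arr f; arr f'; arr g; src f' = src f; tgt f' = tgt f\<rbrakk>
    \<Longrightarrow> (f +\<^sub>m f') \<otimes>\<^sub>m g = f \<otimes>\<^sub>m g +\<^sub>m f' \<otimes>\<^sub>m g"
  by (rule TensorM_Plus_left[of "src f" "tgt f" "src g" "tgt g"]) (simp_all add: Hom_iff)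

lemma tensor_plus_right:
  "\<lbrakk>arr f; arr g; arr g'; src g' = src g; tgt g' = tgt g\<rbrakk>
    \<Longrightarrow> f \<otimes>\<^sub>m (g +\<^sub>m g') = f \<otimes>\<^sub>m g +\<^sub>m f \<otimes>\<^sub>m g'"
  by (rule TensorM_Plus_right[of "src f" "tgt f" "src g" "tgt g"]) (simp_all add: Hom_iff)

text \<open>Scaling by the nonnegative reciprocal \<open>1 / s\<close> undoes scaling by
  \<open>s\<close>. Division of scalars enters the proof here.\<close>

lemma scale_cancel:
  assumes "s *\<^sub>m f = s *\<^sub>m g" "0 < s" "arr f" "arr g"
  shows "f = g"
proof -
  have "(1 / s) *\<^sub>m (s *\<^sub>m h) = h" if "arr h" for h
    using Scale_mult[of "src h" "tgt h" "1 / s" s h] Scale_one[of "src h" "tgt h" h] that assms(2)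
    by (simp add: Hom_iff)
  then show ?thesis using assms by metis
qed

lemma comp_scale_ident:
  assumes "arr f" "tgt f = a" "0 \<le> s"
  shows "f ;; s *\<^sub>m \<i>\<d> a = s *\<^sub>m f"
  using Comp_Scale_right[of "src f" a a s f "\<i>\<d> a"] arr_D[OF assms(1)] assms
  by (auto simp: Ident_in_Hom)

end

section \<open>The opposite category\<close>

definition op_smc :: "('o, 'm, 'x) linear_smc_scheme \<Rightarrow> ('o, 'm, 'x) linear_smc_scheme" where
  "op_smc C = C\<lparr>Hom := \<lambda>a b. Hom C b a, Comp := \<lambda>f g. Comp C g f,
    Symm := \<lambda>a b. Symm C b a, Zero := \<lambda>a b. Zero C b a\<rparr>"

lemma op_smc_simps [simp]:
  "Obj (op_smc C) = Obj C" "Hom (op_smc C) a b = Hom C b a" "Ident (op_smc C) = Ident C"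
  "Comp (op_smc C) f g = Comp C g f" "Unit (op_smc C) = Unit C" "TensorO (op_smc C) = TensorO C"
  "TensorM (op_smc C) = TensorM C" "Symm (op_smc C) a b = Symm C b a"
  "Zero (op_smc C) a b = Zero C b a" "Plus (op_smc C) = Plus C" "Scale (op_smc C) = Scale C"
  by (simp_all add: op_smc_def)

lemma hom_monoid_op_smc [simp]: "hom_monoid (op_smc C) a b = hom_monoid C b a"
  by (simp add: hom_monoid_def)

context Qge0_linear_symmetric_monoidal_category
begin

text \<open>Each axiom turns into itself, its mirror image or its reversed equation, except that the
  hexagon turns into \<open>Symm_hexagon_left\<close>.\<close>

lemma op_smc: "Qge0_linear_symmetric_monoidal_category (op_smc C)"
proof (intro Qge0_linear_symmetric_monoidal_category.intro
    Qge0_linear_symmetric_monoidal_category_axioms.intro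
    strict_symmetric_monoidal_category.intro strict_symmetric_monoidal_category_axioms.intro
    strict_monoidal_category.intro strict_monoidal_category_axioms.intro category.intro;
    unfold op_smc_simps hom_monoid_op_smc)
  show "a = a' \<and> b = b'"
    if "a \<in> Obj C" "b \<in> Obj C" "a' \<in> Obj C" "b' \<in> Obj C" "f \<in> Hom C b a" "f \<in> Hom C b' a'"
    for a b a' b' f
    using Hom_disjoint[of b a b' a' f] that by simp
qed (rule Ident_in_Hom Comp_in_Hom Comp_Ident_left Comp_Ident_right
    Comp_assoc[symmetric] Unit_in_Obj TensorO_in_Obj TensorM_in_Hom TensorM_Ident TensorM_Comp
    TensorO_assoc TensorO_Unit_left TensorO_Unit_right TensorM_assoc TensorM_Unit_left
    TensorM_Unit_right Symm_in_Hom Symm_natural[symmetric] Symm_Symm Symm_hexagon_left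
    Hom_comm_monoid Scale_in_Hom Scale_Plus Scale_Zero Scale_add Scale_zero Scale_mult Scale_one
    Comp_Plus_left Comp_Plus_right Comp_Zero_left Comp_Zero_right Comp_Scale_left Comp_Scale_right
    TensorM_Plus_left TensorM_Plus_right TensorM_Zero_left TensorM_Zero_right
    TensorM_Scale_left TensorM_Scale_right; assumption)+

end


section \<open>The eight laws, the Leibniz rule and commutativity\<close>

locale binomial_laws = Qge0_linear_symmetric_monoidal_category C
  for C :: "('o, 'm, 'x) linear_smc_scheme" (structure) +
  fixes A :: "nat \<Rightarrow> 'o"
    and nabla :: "nat \<Rightarrow> nat \<Rightarrow> 'm"  (\<open>\<nabla>\<close>)
    and Delta :: "nat \<Rightarrow> nat \<Rightarrow> 'm"  (\<open>\<Delta>\<close>)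
    and eta :: 'm  (\<open>\<eta>\<close>)
    and eps :: 'm  (\<open>\<epsilon>\<close>)
  assumes A_in_Obj [simp]: "A n \<in> Obj C"
    and nabla_in_Hom: "\<nabla> n p \<in> Hom C (A n \<otimes>\<^sub>o A p) (A (n + p))"
    and Delta_in_Hom: "\<Delta> n p \<in> Hom C (A (n + p)) (A n \<otimes>\<^sub>o A p)"
    and eta_in_Hom: "\<eta> \<in> Hom C \<I> (A 0)"
    and eps_in_Hom: "\<epsilon> \<in> Hom C (A 0) \<I>"
    and unit_left: "\<eta> \<otimes>\<^sub>m \<i>\<d> (A n) ;; \<nabla> 0 n = \<i>\<d> (A n)"
    and unit_right: "\<i>\<d> (A n) \<otimes>\<^sub>m \<eta> ;; \<nabla> n 0 = \<i>\<d> (A n)"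
    and counit_left: "\<Delta> 0 n ;; \<epsilon> \<otimes>\<^sub>m \<i>\<d> (A n) = \<i>\<d> (A n)"
    and counit_right: "\<Delta> n 0 ;; \<i>\<d> (A n) \<otimes>\<^sub>m \<epsilon> = \<i>\<d> (A n)"
    and nabla_Delta:
      "n + p = q + r \<Longrightarrow>
        \<nabla> n p ;; \<Delta> q r =
          finprod (hom_monoid C (A n \<otimes>\<^sub>o A p) (A q \<otimes>\<^sub>o A r))
            (\<lambda>(a, b, c, d). \<Delta> a b \<otimes>\<^sub>m \<Delta> c d
              ;; \<i>\<d> (A a) \<otimes>\<^sub>m \<gamma> (A b) (A c) \<otimes>\<^sub>m \<i>\<d> (A d)
              ;; \<nabla> a c \<otimes>\<^sub>m \<nabla> b d)
            {(a, b, c, d). a + b = n \<and> c + d = p \<and> a + c = q \<and> b + d = r}"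
    and eta_eps: "\<eta> ;; \<epsilon> = \<i>\<d> \<I>"
    and Delta_nabla:
      "\<Delta> n p ;; \<nabla> n p = of_nat ((n + p) choose n) *\<^sub>m \<i>\<d> (A (n + p))"
    and eps_eta: "\<epsilon> ;; \<eta> = \<i>\<d> (A 0)"
begin

lemma structure_simps [simp]:
  "arr (\<nabla> n p)" "src (\<nabla> n p) = A n \<otimes>\<^sub>o A p" "tgt (\<nabla> n p) = A (n + p)"
  "arr (\<Delta> n p)" "src (\<Delta> n p) = A (n + p)" "tgt (\<Delta> n p) = A n \<otimes>\<^sub>o A p"
  "arr \<eta>" "src \<eta> = \<I>" "tgt \<eta> = A 0"
  "arr \<epsilon>" "src \<epsilon> = A 0" "tgt \<epsilon> = \<I>"
  using Hom_D[OF nabla_in_Hom[of n p]] Hom_D[OF Delta_in_Hom[of n p]]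
    Hom_D[OF eta_in_Hom] Hom_D[OF eps_in_Hom] by simp_all

text \<open>Precomposing the unit law with
  \<open>\<epsilon> \<otimes>\<^sub>m \<i>\<d> (A n)\<close> cancels \<eta> by
  \<open>eps_eta\<close>. The next three lemmas are the mirror image and the duals.\<close>

lemma nabla_zero_left: "\<nabla> 0 n = \<epsilon> \<otimes>\<^sub>m \<i>\<d> (A n)"
proof -
  have "\<epsilon> \<otimes>\<^sub>m \<i>\<d> (A n) = \<epsilon> \<otimes>\<^sub>m \<i>\<d> (A n) ;; (\<eta> \<otimes>\<^sub>m \<i>\<d> (A n) ;; \<nabla> 0 n)"
    unfolding unit_left by simp
  also have "\<dots> = (\<epsilon> \<otimes>\<^sub>m \<i>\<d> (A n) ;; \<eta> \<otimes>\<^sub>m \<i>\<d> (A n)) ;; \<nabla> 0 n"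
    by (subst comp_assoc) simp_all
  also have "\<dots> = \<nabla> 0 n"
    by (simp add: interchange eps_eta)
  finally show ?thesis by simp
qed

lemma nabla_zero_right: "\<nabla> n 0 = \<i>\<d> (A n) \<otimes>\<^sub>m \<epsilon>"
proof -
  have "\<i>\<d> (A n) \<otimes>\<^sub>m \<epsilon> = \<i>\<d> (A n) \<otimes>\<^sub>m \<epsilon> ;; (\<i>\<d> (A n) \<otimes>\<^sub>m \<eta> ;; \<nabla> n 0)"
    unfolding unit_right by simp
  also have "\<dots> = (\<i>\<d> (A n) \<otimes>\<^sub>m \<epsilon> ;; \<i>\<d> (A n) \<otimes>\<^sub>m \<eta>) ;; \<nabla> n 0"
    by (subst comp_assoc) simp_all
  also have "\<dots> = \<nabla> n 0"
    by (simp add: interchange eps_eta)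
  finally show ?thesis by simp
qed

lemma Delta_zero_left: "\<Delta> 0 n = \<eta> \<otimes>\<^sub>m \<i>\<d> (A n)"
proof -
  have "\<eta> \<otimes>\<^sub>m \<i>\<d> (A n) = (\<Delta> 0 n ;; \<epsilon> \<otimes>\<^sub>m \<i>\<d> (A n)) ;; \<eta> \<otimes>\<^sub>m \<i>\<d> (A n)"
    unfolding counit_left by simp
  also have "\<dots> = \<Delta> 0 n"
    by (simp add: interchange eps_eta)
  finally show ?thesis by simp
qed

lemma Delta_zero_right: "\<Delta> n 0 = \<i>\<d> (A n) \<otimes>\<^sub>m \<eta>"
proof -
  have "\<i>\<d> (A n) \<otimes>\<^sub>m \<eta> = (\<Delta> n 0 ;; \<i>\<d> (A n) \<otimes>\<^sub>m \<epsilon>) ;; \<i>\<d> (A n) \<otimes>\<^sub>m \<eta>"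
    unfolding counit_right by simp
  also have "\<dots> = \<Delta> n 0"
    by (simp add: interchange eps_eta)
  finally show ?thesis by simp
qed

text \<open>The Leibniz rule: the piece of degree one is split off either the left or the right
  factor, and in the second case it must cross the left factor.\<close>

lemma nabla_Delta_one:
  "\<nabla> (Suc n) (Suc p) ;; \<Delta> (Suc 0) (Suc (n + p)) =
    (\<Delta> (Suc 0) n \<otimes>\<^sub>m \<i>\<d> (A (Suc p)) ;; \<i>\<d> (A (Suc 0)) \<otimes>\<^sub>m \<nabla> n (Suc p)) +\<^sub>m
    (\<i>\<d> (A (Suc n)) \<otimes>\<^sub>m \<Delta> (Suc 0) p ;; (\<gamma> (A (Suc n)) (A (Suc 0)) \<otimes>\<^sub>m \<i>\<d> (A p)
      ;; \<i>\<d> (A (Suc 0)) \<otimes>\<^sub>m \<nabla> (Suc n) p))"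
  (is "_ = ?L +\<^sub>m ?R")
proof -
  let ?X = "A (Suc n)" and ?Y = "A (Suc p)" and ?u = "A (Suc 0)"
  let ?H = "hom_monoid C (?X \<otimes>\<^sub>o ?Y) (?u \<otimes>\<^sub>o A (Suc (n + p)))"
  interpret H: comm_monoid ?H
    by (rule Hom_comm_monoid) simp_all
  \<comment> \<open>Since a + c = 1, the sum has only the terms with a = 1 and with c = 1.\<close>
  have index: "{(a, b, c, d). a + b = Suc n \<and> c + d = Suc p \<and> a + c = Suc 0 \<and> b + d = Suc (n + p)}
      = {(Suc 0, n, 0, Suc p), (0, Suc n, Suc 0, p)}"
    by auto
  \<comment> \<open>Here \<eta> creates a copy of \<open>A 0\<close> that crosses \<open>A n\<close>
    before \<epsilon> destroys it.\<close>
  have left: "\<Delta> (Suc 0) n \<otimes>\<^sub>m \<Delta> 0 (Suc p) ;; \<i>\<d> ?u \<otimes>\<^sub>m \<gamma> (A n) (A 0) \<otimes>\<^sub>m \<i>\<d> ?Y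
      ;; \<nabla> (Suc 0) 0 \<otimes>\<^sub>m \<nabla> n (Suc p) = ?L" (is "?lhs = _")
  proof -
    have "\<gamma> (A n) (A 0) \<otimes>\<^sub>m \<i>\<d> ?Y ;; \<epsilon> \<otimes>\<^sub>m \<nabla> n (Suc p)
        = \<gamma> (A n) (A 0) \<otimes>\<^sub>m \<i>\<d> ?Y ;; ((\<epsilon> \<otimes>\<^sub>m \<i>\<d> (A n)) \<otimes>\<^sub>m \<i>\<d> ?Y ;; \<nabla> n (Suc p))"
      using interchange[of \<epsilon> "\<i>\<d> \<I>" "\<i>\<d> (A n \<otimes>\<^sub>o ?Y)" "\<nabla> n (Suc p)"] by simp
    also have "\<dots> = (\<gamma> (A n) (A 0) ;; \<epsilon> \<otimes>\<^sub>m \<i>\<d> (A n)) \<otimes>\<^sub>m \<i>\<d> ?Y ;; \<nabla> n (Suc p)"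
      by (simp add: interchange del: tensor_assoc comp_assoc add: comp_assoc[symmetric])
    \<comment> \<open>By naturality \<epsilon> moves through the crossing, which becomes a crossing
      with \<open>\<I>\<close> and hence an identity.\<close>
    also have "\<gamma> (A n) (A 0) ;; \<epsilon> \<otimes>\<^sub>m \<i>\<d> (A n) = \<i>\<d> (A n) \<otimes>\<^sub>m \<epsilon>"
      using symm_natural[of "\<i>\<d> (A n)" \<epsilon>] by simp
    finally have *: "\<gamma> (A n) (A 0) \<otimes>\<^sub>m \<i>\<d> ?Y ;; \<epsilon> \<otimes>\<^sub>m \<nabla> n (Suc p)
        = (\<i>\<d> (A n) \<otimes>\<^sub>m \<epsilon>) \<otimes>\<^sub>m \<i>\<d> ?Y ;; \<nabla> n (Suc p)" .
    have "?lhs = \<Delta> (Suc 0) n \<otimes>\<^sub>m (\<eta> \<otimes>\<^sub>m \<i>\<d> ?Y) ;;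
        (\<i>\<d> ?u \<otimes>\<^sub>m (\<gamma> (A n) (A 0) \<otimes>\<^sub>m \<i>\<d> ?Y ;; \<epsilon> \<otimes>\<^sub>m \<nabla> n (Suc p)))"
      by (simp add: Delta_zero_left nabla_zero_right interchange)
    also have "\<dots> = \<Delta> (Suc 0) n \<otimes>\<^sub>m (\<eta> \<otimes>\<^sub>m \<i>\<d> ?Y) ;;
        (\<i>\<d> (?u \<otimes>\<^sub>o A n) \<otimes>\<^sub>m (\<epsilon> \<otimes>\<^sub>m \<i>\<d> ?Y) ;; \<i>\<d> ?u \<otimes>\<^sub>m \<nabla> n (Suc p))"
      unfolding * by (simp add: interchange flip: TensorM_Ident)
    also have "\<dots> = (\<Delta> (Suc 0) n \<otimes>\<^sub>m (\<eta> \<otimes>\<^sub>m \<i>\<d> ?Y) ;;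
        \<i>\<d> (?u \<otimes>\<^sub>o A n) \<otimes>\<^sub>m (\<epsilon> \<otimes>\<^sub>m \<i>\<d> ?Y)) ;; \<i>\<d> ?u \<otimes>\<^sub>m \<nabla> n (Suc p)"
      by (subst comp_assoc) simp_all
    also have "\<dots> = ?L"
      by (subst interchange; simp add: interchange eta_eps)
    finally show ?thesis .
  qed
  have right: "\<Delta> 0 (Suc n) \<otimes>\<^sub>m \<Delta> (Suc 0) p ;; \<i>\<d> (A 0) \<otimes>\<^sub>m \<gamma> ?X ?u \<otimes>\<^sub>m \<i>\<d> (A p)
      ;; \<nabla> 0 (Suc 0) \<otimes>\<^sub>m \<nabla> (Suc n) p = ?R"
    by (simp add: Delta_zero_left nabla_zero_left interchange eta_eps)
  have "?L \<in> carrier ?H" "?R \<in> carrier ?H"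
    by (simp_all add: hom_monoid_def Hom_iff)
  with left right show ?thesis
    \<comment> \<open>The two-term \<open>finprod\<close> is evaluated while
      \<open>hom_monoid\<close> is still folded; only then is its multiplication read as the sum of
      morphisms.\<close>
    using nabla_Delta[of "Suc n" "Suc p" "Suc 0" "Suc (n + p)"] unfolding index
    by (simp add: Pi_def) (simp add: hom_monoid_def)
qed

text \<open>Composing further with \<open>\<nabla> (Suc 0) n\<close> leaves the binomial coefficient
  of 1 out of n + 1, that is the scalar n + 1, which \<open>scale_cancel\<close> removes.\<close>

lemma Delta_one_cancel:
  assumes "f ;; \<Delta> (Suc 0) n = g ;; \<Delta> (Suc 0) n"
    and [simp]: "arr f" "arr g" "tgt f = A (Suc n)" "tgt g = A (Suc n)"
  shows "f = g"
proof (rule scale_cancel)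
  have "h ;; \<Delta> (Suc 0) n ;; \<nabla> (Suc 0) n = of_nat (Suc n) *\<^sub>m h"
    if "arr h" "tgt h = A (Suc n)" for h
    using that by (simp add: Delta_nabla comp_scale_ident)
  from this[of f] this[of g] assms(1) show "of_nat (Suc n) *\<^sub>m f = of_nat (Suc n) *\<^sub>m g"
    by simp
qed simp_all

text \<open>If one degree is zero, naturality of the symmetry at \<epsilon> suffices. Otherwise,
  precomposition with \<gamma> exchanges the two Leibniz summands, up to the statement in total
  degree one lower.\<close>

lemma nabla_comm: "\<gamma> (A n) (A p) ;; \<nabla> p n = \<nabla> n p"
proof (induction "n + p" arbitrary: n p rule: less_induct)
  case less
  consider "n = 0" | "p = 0" | m q where "n = Suc m" "p = Suc q"
    by (meson not0_implies_Suc)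
  then show ?case
  proof cases
    case 1
    then show ?thesis
      using symm_natural[of \<epsilon> "\<i>\<d> (A p)"] by (simp add: nabla_zero_left nabla_zero_right)
  next
    case 2
    then show ?thesis
      using symm_natural[of "\<i>\<d> (A n)" \<epsilon>] by (simp add: nabla_zero_left nabla_zero_right)
  next
    case (3 m q)
    let ?X = "A (Suc m)" and ?Y = "A (Suc q)" and ?u = "A (Suc 0)"
    have L: "\<gamma> ?X ?Y ;; (\<Delta> (Suc 0) q \<otimes>\<^sub>m \<i>\<d> ?X ;; \<i>\<d> ?u \<otimes>\<^sub>m \<nabla> q (Suc m))
        = \<i>\<d> ?X \<otimes>\<^sub>m \<Delta> (Suc 0) q ;; (\<gamma> ?X ?u \<otimes>\<^sub>m \<i>\<d> (A q) ;; \<i>\<d> ?u \<otimes>\<^sub>m \<nabla> (Suc m) q)"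
      (is "?l = _")
    proof -
      have "?l = (\<gamma> ?X ?Y ;; \<Delta> (Suc 0) q \<otimes>\<^sub>m \<i>\<d> ?X) ;; \<i>\<d> ?u \<otimes>\<^sub>m \<nabla> q (Suc m)"
        by simp
      \<comment> \<open>The hexagon separates the crossing with the split-off \<open>?u\<close> from
        the crossing with \<open>A q\<close>; the induction hypothesis absorbs the latter.\<close>
      also have "\<gamma> ?X ?Y ;; \<Delta> (Suc 0) q \<otimes>\<^sub>m \<i>\<d> ?X
          = \<i>\<d> ?X \<otimes>\<^sub>m \<Delta> (Suc 0) q ;; (\<gamma> ?X ?u \<otimes>\<^sub>m \<i>\<d> (A q) ;; \<i>\<d> ?u \<otimes>\<^sub>m \<gamma> ?X (A q))"
        using symm_natural[of "\<i>\<d> ?X" "\<Delta> (Suc 0) q"] by (simp add: Symm_hexagon)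
      also have "\<dots> ;; \<i>\<d> ?u \<otimes>\<^sub>m \<nabla> q (Suc m) = \<i>\<d> ?X \<otimes>\<^sub>m \<Delta> (Suc 0) q ;;
          (\<gamma> ?X ?u \<otimes>\<^sub>m \<i>\<d> (A q) ;; \<i>\<d> ?u \<otimes>\<^sub>m (\<gamma> ?X (A q) ;; \<nabla> q (Suc m)))"
        by (simp add: interchange)
      finally show ?thesis
        using less[of "Suc m" q] 3 by simp
    qed
    \<comment> \<open>Dually, the crossing of \<open>?u\<close> contained in the Leibniz summand
      cancels against one coming from \<open>\<gamma> ?X ?Y\<close>.\<close>
    have R: "\<gamma> ?X ?Y ;; (\<i>\<d> ?Y \<otimes>\<^sub>m \<Delta> (Suc 0) m ;; (\<gamma> ?Y ?u \<otimes>\<^sub>m \<i>\<d> (A m)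
          ;; \<i>\<d> ?u \<otimes>\<^sub>m \<nabla> (Suc q) m))
        = \<Delta> (Suc 0) m \<otimes>\<^sub>m \<i>\<d> ?Y ;; \<i>\<d> ?u \<otimes>\<^sub>m \<nabla> m (Suc q)"
      (is "?r = _")
    proof -
      have "?r = (\<gamma> ?X ?Y ;; \<i>\<d> ?Y \<otimes>\<^sub>m \<Delta> (Suc 0) m) ;; (\<gamma> ?Y ?u \<otimes>\<^sub>m \<i>\<d> (A m)
          ;; \<i>\<d> ?u \<otimes>\<^sub>m \<nabla> (Suc q) m)"
        by simp
      also have "\<gamma> ?X ?Y ;; \<i>\<d> ?Y \<otimes>\<^sub>m \<Delta> (Suc 0) m
          = \<Delta> (Suc 0) m \<otimes>\<^sub>m \<i>\<d> ?Y ;; (\<i>\<d> ?u \<otimes>\<^sub>m \<gamma> (A m) ?Y ;; \<gamma> ?u ?Y \<otimes>\<^sub>m \<i>\<d> (A m))"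
        using symm_natural[of "\<Delta> (Suc 0) m" "\<i>\<d> ?Y"] by (simp add: Symm_hexagon_left)
      also have "\<dots> ;; (\<gamma> ?Y ?u \<otimes>\<^sub>m \<i>\<d> (A m) ;; \<i>\<d> ?u \<otimes>\<^sub>m \<nabla> (Suc q) m)
          = \<Delta> (Suc 0) m \<otimes>\<^sub>m \<i>\<d> ?Y ;; (\<i>\<d> ?u \<otimes>\<^sub>m \<gamma> (A m) ?Y ;;
            ((\<gamma> ?u ?Y \<otimes>\<^sub>m \<i>\<d> (A m) ;; \<gamma> ?Y ?u \<otimes>\<^sub>m \<i>\<d> (A m)) ;; \<i>\<d> ?u \<otimes>\<^sub>m \<nabla> (Suc q) m))"
        by simp
      also have "\<gamma> ?u ?Y \<otimes>\<^sub>m \<i>\<d> (A m) ;; \<gamma> ?Y ?u \<otimes>\<^sub>m \<i>\<d> (A m) = \<i>\<d> (?u \<otimes>\<^sub>o ?Y \<otimes>\<^sub>o A m)"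
        by (simp add: interchange Symm_Symm)
      also have "\<Delta> (Suc 0) m \<otimes>\<^sub>m \<i>\<d> ?Y ;; (\<i>\<d> ?u \<otimes>\<^sub>m \<gamma> (A m) ?Y ;;
            (\<i>\<d> (?u \<otimes>\<^sub>o ?Y \<otimes>\<^sub>o A m) ;; \<i>\<d> ?u \<otimes>\<^sub>m \<nabla> (Suc q) m))
          = \<Delta> (Suc 0) m \<otimes>\<^sub>m \<i>\<d> ?Y ;; \<i>\<d> ?u \<otimes>\<^sub>m (\<gamma> (A m) ?Y ;; \<nabla> (Suc q) m)"
        by (simp add: interchange)
      finally show ?thesis
        using less[of m "Suc q"] 3 by simp
    qed
    have "\<gamma> ?X ?Y ;; \<nabla> (Suc q) (Suc m) = \<nabla> (Suc m) (Suc q)"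
    proof (rule Delta_one_cancel)
      have "(\<gamma> ?X ?Y ;; \<nabla> (Suc q) (Suc m)) ;; \<Delta> (Suc 0) (Suc (m + q))
          = \<gamma> ?X ?Y ;; (\<nabla> (Suc q) (Suc m) ;; \<Delta> (Suc 0) (Suc (q + m)))"
        by (simp add: add.commute)
      also have "\<dots> = \<nabla> (Suc m) (Suc q) ;; \<Delta> (Suc 0) (Suc (m + q))"
        unfolding nabla_Delta_one
        \<comment> \<open>\<open>L\<close> and \<open>R\<close> yield the two summands in exchanged
          order, hence the commuted sum.\<close>
        by (subst plus_commute) (simp_all add: comp_plus_right L R add.commute)
      finally show "(\<gamma> ?X ?Y ;; \<nabla> (Suc q) (Suc m)) ;; \<Delta> (Suc 0) (Suc (m + q))
          = \<nabla> (Suc m) (Suc q) ;; \<Delta> (Suc 0) (Suc (m + q))" .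
    qed (simp_all add: add.commute)
    with 3 show ?thesis by simp
  qed
qed


section \<open>Associativity\<close>

lemmas slices = tensor_comp_ident tensor_ident_comp tensor_ident_ident

text \<open>For positive degrees, either side followed by the degree-one \<Delta> is a sum of three
  terms, according to the factor that gives up its piece of degree one. The induction hypothesis
  matches them term by term.\<close>

lemma nabla_assoc:
  "\<nabla> n p \<otimes>\<^sub>m \<i>\<d> (A q) ;; \<nabla> (n + p) q = \<i>\<d> (A n) \<otimes>\<^sub>m \<nabla> p q ;; \<nabla> n (p + q)"
proof (induction "n + p + q" arbitrary: n p q rule: less_induct)
  case less
  consider "n = 0" | "p = 0" | "q = 0" | k l m where "n = Suc k" "p = Suc l" "q = Suc m"
    by (meson not0_implies_Suc)
  then show ?case
  proof cases
    case 1
    then show ?thesis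
      using slide[of \<epsilon> "\<nabla> p q"] by (simp add: nabla_zero_left)
  next
    case 2
    then show ?thesis
      by (simp add: nabla_zero_left nabla_zero_right)
  next
    case 3
    then show ?thesis
      using slide[of "\<nabla> n p" \<epsilon>] by (simp add: nabla_zero_right slices)
  next
    case (4 k l m)
    let ?X = "A (Suc k)" and ?Y = "A (Suc l)" and ?Z = "A (Suc m)" and ?u = "A (Suc 0)"
    \<comment> \<open>The piece comes from \<open>?X\<close>, \<open>?Y\<close>, \<open>?Z\<close>
      respectively; the remaining product is bracketed to the left in all three.\<close>
    let ?T1 = "\<Delta> (Suc 0) k \<otimes>\<^sub>m \<i>\<d> (?Y \<otimes>\<^sub>o ?Z)
      ;; \<i>\<d> ?u \<otimes>\<^sub>m (\<nabla> k (Suc l) \<otimes>\<^sub>m \<i>\<d> ?Z ;; \<nabla> (k + Suc l) (Suc m))"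
    let ?T2 = "\<i>\<d> ?X \<otimes>\<^sub>m \<Delta> (Suc 0) l \<otimes>\<^sub>m \<i>\<d> ?Z ;; (\<gamma> ?X ?u \<otimes>\<^sub>m \<i>\<d> (A l \<otimes>\<^sub>o ?Z)
      ;; \<i>\<d> ?u \<otimes>\<^sub>m (\<nabla> (Suc k) l \<otimes>\<^sub>m \<i>\<d> ?Z ;; \<nabla> (Suc k + l) (Suc m)))"
    let ?T3 = "\<i>\<d> (?X \<otimes>\<^sub>o ?Y) \<otimes>\<^sub>m \<Delta> (Suc 0) m ;; (\<gamma> (?X \<otimes>\<^sub>o ?Y) ?u \<otimes>\<^sub>m \<i>\<d> (A m)
      ;; \<i>\<d> ?u \<otimes>\<^sub>m (\<nabla> (Suc k) (Suc l) \<otimes>\<^sub>m \<i>\<d> (A m) ;; \<nabla> (Suc k + Suc l) m))"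
    have IH1: "\<nabla> k (Suc l) \<otimes>\<^sub>m \<i>\<d> ?Z ;; \<nabla> (k + Suc l) (Suc m)
        = \<i>\<d> (A k) \<otimes>\<^sub>m \<nabla> (Suc l) (Suc m) ;; \<nabla> k (Suc l + Suc m)"
      by (rule less) (simp add: 4)
    have IH2: "\<nabla> (Suc k) l \<otimes>\<^sub>m \<i>\<d> ?Z ;; \<nabla> (Suc k + l) (Suc m)
        = \<i>\<d> ?X \<otimes>\<^sub>m \<nabla> l (Suc m) ;; \<nabla> (Suc k) (l + Suc m)"
      by (rule less) (simp add: 4)
    have IH3: "\<nabla> (Suc k) (Suc l) \<otimes>\<^sub>m \<i>\<d> (A m) ;; \<nabla> (Suc k + Suc l) m
        = \<i>\<d> ?X \<otimes>\<^sub>m \<nabla> (Suc l) m ;; \<nabla> (Suc k) (Suc l + m)"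
      by (rule less) (simp add: 4)

    \<comment> \<open>The piece comes from the inner product, so a second use of the Leibniz rule
      splits the term.\<close>
    have A1: "\<nabla> (Suc k) (Suc l) \<otimes>\<^sub>m \<i>\<d> ?Z ;; (\<Delta> (Suc 0) (Suc (k + l)) \<otimes>\<^sub>m \<i>\<d> ?Z
        ;; \<i>\<d> ?u \<otimes>\<^sub>m \<nabla> (Suc (k + l)) (Suc m)) = ?T1 +\<^sub>m ?T2" (is "?l = _")
    proof -
      have "?l = (\<nabla> (Suc k) (Suc l) ;; \<Delta> (Suc 0) (Suc (k + l))) \<otimes>\<^sub>m \<i>\<d> ?Z
          ;; \<i>\<d> ?u \<otimes>\<^sub>m \<nabla> (Suc (k + l)) (Suc m)"
        by (simp add: slices)
      also have "\<dots> = ?T1 +\<^sub>m ?T2"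
        unfolding nabla_Delta_one
        by (simp add: tensor_plus_left comp_plus_left slices)
      finally show ?thesis .
    qed
    \<comment> \<open>The piece comes from \<open>?Z\<close>: the inner product slides past the
      splitting and, by naturality, through the crossing.\<close>
    have A2: "\<nabla> (Suc k) (Suc l) \<otimes>\<^sub>m \<i>\<d> ?Z ;; (\<i>\<d> (A (Suc (Suc (k + l)))) \<otimes>\<^sub>m \<Delta> (Suc 0) m
        ;; (\<gamma> (A (Suc (Suc (k + l)))) ?u \<otimes>\<^sub>m \<i>\<d> (A m)
        ;; \<i>\<d> ?u \<otimes>\<^sub>m \<nabla> (Suc (Suc (k + l))) m)) = ?T3" (is "?l = _")
    proof -
      let ?W = "\<i>\<d> ?u \<otimes>\<^sub>m \<nabla> (Suc (Suc (k + l))) m"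
      have "?l = (\<nabla> (Suc k) (Suc l) \<otimes>\<^sub>m \<i>\<d> ?Z ;; \<i>\<d> (A (Suc (Suc (k + l)))) \<otimes>\<^sub>m \<Delta> (Suc 0) m)
          ;; (\<gamma> (A (Suc (Suc (k + l)))) ?u \<otimes>\<^sub>m \<i>\<d> (A m) ;; ?W)"
        by simp
      also have "\<dots> = (\<i>\<d> (?X \<otimes>\<^sub>o ?Y) \<otimes>\<^sub>m \<Delta> (Suc 0) m ;; \<nabla> (Suc k) (Suc l) \<otimes>\<^sub>m \<i>\<d> (?u \<otimes>\<^sub>o A m))
          ;; (\<gamma> (A (Suc (Suc (k + l)))) ?u \<otimes>\<^sub>m \<i>\<d> (A m) ;; ?W)"
        using slide[of "\<nabla> (Suc k) (Suc l)" "\<Delta> (Suc 0) m"] by simp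
      also have "\<dots> = \<i>\<d> (?X \<otimes>\<^sub>o ?Y) \<otimes>\<^sub>m \<Delta> (Suc 0) m ;; ((\<nabla> (Suc k) (Suc l) \<otimes>\<^sub>m \<i>\<d> ?u
          ;; \<gamma> (A (Suc (Suc (k + l)))) ?u) \<otimes>\<^sub>m \<i>\<d> (A m) ;; ?W)"
        by (simp add: slices)
      also have "\<nabla> (Suc k) (Suc l) \<otimes>\<^sub>m \<i>\<d> ?u ;; \<gamma> (A (Suc (Suc (k + l)))) ?u
          = \<gamma> (?X \<otimes>\<^sub>o ?Y) ?u ;; \<i>\<d> ?u \<otimes>\<^sub>m \<nabla> (Suc k) (Suc l)"
        using symm_natural[of "\<nabla> (Suc k) (Suc l)" "\<i>\<d> ?u"] by simp
      finally show ?thesis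
        by (simp add: slices)
    qed
    have B1: "\<i>\<d> ?X \<otimes>\<^sub>m \<nabla> (Suc l) (Suc m) ;; (\<Delta> (Suc 0) k \<otimes>\<^sub>m \<i>\<d> (A (Suc (Suc (l + m))))
        ;; \<i>\<d> ?u \<otimes>\<^sub>m \<nabla> k (Suc (Suc (l + m)))) = ?T1" (is "?l = _")
    proof -
      have "?l = (\<i>\<d> ?X \<otimes>\<^sub>m \<nabla> (Suc l) (Suc m) ;; \<Delta> (Suc 0) k \<otimes>\<^sub>m \<i>\<d> (A (Suc (Suc (l + m)))))
        ;; \<i>\<d> ?u \<otimes>\<^sub>m \<nabla> k (Suc (Suc (l + m)))"
        by simp
      also have "\<i>\<d> ?X \<otimes>\<^sub>m \<nabla> (Suc l) (Suc m) ;; \<Delta> (Suc 0) k \<otimes>\<^sub>m \<i>\<d> (A (Suc (Suc (l + m))))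
          = \<Delta> (Suc 0) k \<otimes>\<^sub>m \<i>\<d> (?Y \<otimes>\<^sub>o ?Z) ;; \<i>\<d> (?u \<otimes>\<^sub>o A k) \<otimes>\<^sub>m \<nabla> (Suc l) (Suc m)"
        using slide[of "\<Delta> (Suc 0) k" "\<nabla> (Suc l) (Suc m)"] by simp
      finally show ?thesis
        unfolding IH1 by (simp add: slices)
    qed
    have B2: "\<i>\<d> ?X \<otimes>\<^sub>m \<nabla> (Suc l) (Suc m) ;; (\<i>\<d> ?X \<otimes>\<^sub>m \<Delta> (Suc 0) (Suc (l + m))
        ;; (\<gamma> ?X ?u \<otimes>\<^sub>m \<i>\<d> (A (Suc (l + m))) ;; \<i>\<d> ?u \<otimes>\<^sub>m \<nabla> (Suc k) (Suc (l + m))))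
        = ?T2 +\<^sub>m ?T3" (is "?l = _")
    proof -
      let ?W = "\<i>\<d> ?u \<otimes>\<^sub>m \<nabla> (Suc k) (Suc (l + m))"
      let ?V = "\<gamma> ?X ?u \<otimes>\<^sub>m \<i>\<d> (A (Suc (l + m))) ;; ?W"
      \<comment> \<open>This moves an inner product past the crossing until it meets
        \<open>\<nabla> (Suc k)\<close>, giving the right-bracketed side of an induction hypothesis.
        It serves both \<open>T2\<close> and \<open>T3\<close>.\<close>
      have slide2: "\<i>\<d> (?X \<otimes>\<^sub>o ?u) \<otimes>\<^sub>m g ;; ?V
          = \<gamma> ?X ?u \<otimes>\<^sub>m \<i>\<d> (src g) ;; \<i>\<d> ?u \<otimes>\<^sub>m (\<i>\<d> ?X \<otimes>\<^sub>m g ;; \<nabla> (Suc k) (Suc (l + m)))"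
        if [simp]: "arr g" "tgt g = A (Suc (l + m))" for g
      proof -
        have "\<i>\<d> (?X \<otimes>\<^sub>o ?u) \<otimes>\<^sub>m g ;; ?V
            = (\<i>\<d> (?X \<otimes>\<^sub>o ?u) \<otimes>\<^sub>m g ;; \<gamma> ?X ?u \<otimes>\<^sub>m \<i>\<d> (A (Suc (l + m)))) ;; ?W"
          by simp
        also have "\<i>\<d> (?X \<otimes>\<^sub>o ?u) \<otimes>\<^sub>m g ;; \<gamma> ?X ?u \<otimes>\<^sub>m \<i>\<d> (A (Suc (l + m)))
            = \<gamma> ?X ?u \<otimes>\<^sub>m \<i>\<d> (src g) ;; \<i>\<d> (?u \<otimes>\<^sub>o ?X) \<otimes>\<^sub>m g"
          using slide[of "\<gamma> ?X ?u" g] by simp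
        finally show ?thesis
          by (simp add: slices)
      qed
      have T2: "\<i>\<d> ?X \<otimes>\<^sub>m (\<Delta> (Suc 0) l \<otimes>\<^sub>m \<i>\<d> ?Z ;; \<i>\<d> ?u \<otimes>\<^sub>m \<nabla> l (Suc m)) ;; ?V = ?T2"
        unfolding IH2 using slide2[of "\<nabla> l (Suc m)"] by (simp add: slices)
      \<comment> \<open>The piece crosses \<open>?Y\<close> and then \<open>?X\<close>;
        \<open>Symm_hexagon_left\<close> identifies this with the single crossing in
        \<open>?T3\<close>.\<close>
      have T3: "\<i>\<d> ?X \<otimes>\<^sub>m (\<i>\<d> ?Y \<otimes>\<^sub>m \<Delta> (Suc 0) m ;; (\<gamma> ?Y ?u \<otimes>\<^sub>m \<i>\<d> (A m)
          ;; \<i>\<d> ?u \<otimes>\<^sub>m \<nabla> (Suc l) m)) ;; ?V = ?T3"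
        unfolding IH3 using slide2[of "\<nabla> (Suc l) m"] by (simp add: slices Symm_hexagon_left)
      have "?l = \<i>\<d> ?X \<otimes>\<^sub>m (\<nabla> (Suc l) (Suc m) ;; \<Delta> (Suc 0) (Suc (l + m))) ;; ?V"
        by (simp add: slices)
      also have "\<dots> = ?T2 +\<^sub>m ?T3"
        unfolding nabla_Delta_one T2[symmetric] T3[symmetric]
        by (simp add: tensor_plus_right comp_plus_left)
      finally show ?thesis .
    qed
    have "\<nabla> (Suc k) (Suc l) \<otimes>\<^sub>m \<i>\<d> ?Z ;; \<nabla> (Suc k + Suc l) (Suc m)
        = \<i>\<d> ?X \<otimes>\<^sub>m \<nabla> (Suc l) (Suc m) ;; \<nabla> (Suc k) (Suc l + Suc m)" (is "?l = ?r")
    proof (rule Delta_one_cancel)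
      have "?l ;; \<Delta> (Suc 0) (Suc (Suc (k + l + m))) = \<nabla> (Suc k) (Suc l) \<otimes>\<^sub>m \<i>\<d> ?Z
          ;; (\<nabla> (Suc (Suc (k + l))) (Suc m) ;; \<Delta> (Suc 0) (Suc (Suc (k + l) + m)))"
        by (simp add: add.assoc)
      also have "\<dots> = (?T1 +\<^sub>m ?T2) +\<^sub>m ?T3"
        unfolding nabla_Delta_one A1[symmetric] A2[symmetric]
        by (simp add: comp_plus_right)
      \<comment> \<open>Left bracketing groups the terms as \<open>A1\<close> then
        \<open>A2\<close>, right bracketing as \<open>B1\<close> then \<open>B2\<close>.\<close>
      also have "\<dots> = ?T1 +\<^sub>m (?T2 +\<^sub>m ?T3)"
        by (rule plus_assoc) (simp_all add: add.assoc)
      also have "\<dots> = \<i>\<d> ?X \<otimes>\<^sub>m \<nabla> (Suc l) (Suc m)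
          ;; (\<nabla> (Suc k) (Suc (Suc (l + m))) ;; \<Delta> (Suc 0) (Suc (k + Suc (l + m))))"
        unfolding nabla_Delta_one B1[symmetric] B2[symmetric]
        by (simp add: comp_plus_right)
      also have "\<dots> = ?r ;; \<Delta> (Suc 0) (Suc (Suc (k + l + m)))"
        by (simp add: add.assoc)
      finally show "?l ;; \<Delta> (Suc 0) (Suc (Suc (k + l + m))) = ?r ;; \<Delta> (Suc 0) (Suc (Suc (k + l + m)))" .
    qed (simp_all add: add.assoc)
    with 4 show ?thesis by simp
  qed
qed

section \<open>Duality and the equivalence\<close>

lemma op_laws: "binomial_laws (op_smc C) A \<Delta> \<nabla> \<epsilon> \<eta>"
proof (intro binomial_laws.intro op_smc binomial_laws_axioms.intro;
    unfold op_smc_simps hom_monoid_op_smc)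
  fix n p q r :: nat
  assume *: "n + p = q + r"
  let ?H = "hom_monoid C (A q \<otimes>\<^sub>o A r) (A n \<otimes>\<^sub>o A p)"
  let ?f = "\<lambda>(a, b, c, d). \<Delta> a b \<otimes>\<^sub>m \<Delta> c d
      ;; \<i>\<d> (A a) \<otimes>\<^sub>m \<gamma> (A b) (A c) \<otimes>\<^sub>m \<i>\<d> (A d) ;; \<nabla> a c \<otimes>\<^sub>m \<nabla> b d"
  \<comment> \<open>The indices form a 2 by 2 array with row sums n, p and column sums q, r. Duality
    exchanges rows and columns, so the sum is reindexed by the transposition of b and c.\<close>
  let ?h = "\<lambda>(a, b, c, d). (a, c, b, d) :: nat \<times> nat \<times> nat \<times> nat"
  let ?S = "{(a, b, c, d). a + b = n \<and> c + d = p \<and> a + c = q \<and> b + d = r}"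
  have S: "{(a, b, c, d). a + b = q \<and> c + d = r \<and> a + c = n \<and> b + d = p} = ?h ` ?S"
    by (auto simp: image_iff)
  interpret H: comm_monoid ?H
    by (rule Hom_comm_monoid) simp_all
  have "\<nabla> q r ;; \<Delta> n p = finprod ?H ?f (?h ` ?S)"
    using nabla_Delta[of q r n p] * unfolding S by simp
  also have "\<dots> = finprod ?H (\<lambda>x. ?f (?h x)) ?S"
    by (rule H.finprod_reindex) (auto simp: hom_monoid_def Hom_iff inj_on_def)
  \<comment> \<open>Written with the opposite composition, the summand unfolds by
    \<open>simp\<close> to the reversed, right-nested composite of the goal.\<close>
  also have "\<dots> = finprod ?H (\<lambda>(a, b, c, d). \<nabla> a b \<otimes>\<^sub>m \<nabla> c d
      ;;\<^bsub>op_smc C\<^esub> \<i>\<d> (A a) \<otimes>\<^sub>m \<gamma> (A c) (A b) \<otimes>\<^sub>m \<i>\<d> (A d) ;;\<^bsub>op_smc C\<^esub> \<Delta> a c \<otimes>\<^sub>m \<Delta> b d) ?S"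
    by (rule H.finprod_cong') (auto simp: hom_monoid_def Hom_iff)
  finally show "\<nabla> q r ;; \<Delta> n p = finprod ?H (\<lambda>(a, b, c, d). \<Delta> a c \<otimes>\<^sub>m \<Delta> b d ;;
      (\<i>\<d> (A a) \<otimes>\<^sub>m \<gamma> (A c) (A b) \<otimes>\<^sub>m \<i>\<d> (A d) ;; \<nabla> a b \<otimes>\<^sub>m \<nabla> c d)) ?S"
    by simp
qed (simp_all add: nabla_in_Hom Delta_in_Hom eta_in_Hom eps_in_Hom unit_left unit_right
    counit_left counit_right eta_eps eps_eta Delta_nabla)

lemma binomial_bimonoid: "binomial_bimonoid C A \<nabla> \<Delta> \<eta> \<epsilon>"
proof unfold_locales
  interpret op: binomial_laws "op_smc C" A \<Delta> \<nabla> \<epsilon> \<eta>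
    by (rule op_laws)
  show "\<Delta> n p ;; \<gamma> (A n) (A p) = \<Delta> p n" for n p
    \<comment> \<open>The arguments are swapped because the opposite symmetry at \<open>A p\<close>,
      \<open>A n\<close> is \<open>\<gamma> (A n) (A p)\<close>.\<close>
    using op.nabla_comm[of p n] by simp
  show "\<Delta> (n + p) q ;; \<Delta> n p \<otimes>\<^sub>m \<i>\<d> (A q) = \<Delta> n (p + q) ;; \<i>\<d> (A n) \<otimes>\<^sub>m \<Delta> p q" for n p q
    using op.nabla_assoc[of n p q] by simp
  show "\<nabla> 0 0 ;; \<epsilon> = \<epsilon> \<otimes>\<^sub>m \<epsilon>"
    using interchange[of \<epsilon> "\<i>\<d> \<I>" "\<i>\<d> (A 0)" \<epsilon>] by (simp add: nabla_zero_left)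
  show "\<eta> ;; \<Delta> 0 0 = \<eta> \<otimes>\<^sub>m \<eta>"
    using interchange[of "\<i>\<d> \<I>" \<eta> \<eta> "\<i>\<d> (A 0)"] by (simp add: Delta_zero_left)
qed (rule A_in_Obj nabla_in_Hom Delta_in_Hom eta_in_Hom eps_in_Hom unit_left counit_left eta_eps
    eps_eta Delta_nabla nabla_Delta nabla_comm nabla_assoc; assumption)+

end

text \<open>Only the right unit and counit laws need an argument: the symmetry carries the left laws
  to them, by (co)commutativity and naturality at \<eta> and \<epsilon>.\<close>

lemma (in binomial_bimonoid) laws: "binomial_laws C A \<nabla> \<Delta> \<eta> \<epsilon>"
proof unfold_locales
  note [simp] = A_in_Obj Hom_D[OF eta_in_Hom] Hom_D[OF eps_in_Hom]
    Hom_D[OF nabla_in_Hom] Hom_D[OF Delta_in_Hom]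
  show "\<i>\<d> (A n) \<otimes>\<^sub>m \<eta> ;; \<nabla> n 0 = \<i>\<d> (A n)" for n
  proof -
    have "\<i>\<d> (A n) \<otimes>\<^sub>m \<eta> ;; \<nabla> n 0 = (\<i>\<d> (A n) \<otimes>\<^sub>m \<eta> ;; \<gamma> (A n) (A 0)) ;; \<nabla> 0 n"
      unfolding comm[of n 0, symmetric] by simp
    also have "\<i>\<d> (A n) \<otimes>\<^sub>m \<eta> ;; \<gamma> (A n) (A 0) = \<eta> \<otimes>\<^sub>m \<i>\<d> (A n)"
      using symm_natural[of "\<i>\<d> (A n)" \<eta>] by simp
    finally show ?thesis
      using unital by simp
  qed
  show "\<Delta> n 0 ;; \<i>\<d> (A n) \<otimes>\<^sub>m \<epsilon> = \<i>\<d> (A n)" for n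
  proof -
    have "\<Delta> n 0 ;; \<i>\<d> (A n) \<otimes>\<^sub>m \<epsilon> = \<Delta> 0 n ;; (\<gamma> (A 0) (A n) ;; \<i>\<d> (A n) \<otimes>\<^sub>m \<epsilon>)"
      unfolding cocomm[of 0 n, symmetric] by simp
    also have "\<gamma> (A 0) (A n) ;; \<i>\<d> (A n) \<otimes>\<^sub>m \<epsilon> = \<epsilon> \<otimes>\<^sub>m \<i>\<d> (A n)"
      using symm_natural[of \<epsilon> "\<i>\<d> (A n)"] by simp
    finally show ?thesis
      using counital by simp
  qed
qed (rule A_in_Obj nabla_in_Hom Delta_in_Hom eta_in_Hom eps_in_Hom unital counital eta_eps
    eps_eta Delta_nabla nabla_Delta; assumption)+


theorem theorem25:
  fixes C :: "('o, 'm, 'x) linear_smc_scheme" (structure)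
    and A :: "nat \<Rightarrow> 'o"
    and nabla :: "nat \<Rightarrow> nat \<Rightarrow> 'm"  (\<open>\<nabla>\<close>)
    and Delta :: "nat \<Rightarrow> nat \<Rightarrow> 'm"  (\<open>\<Delta>\<close>)
    and eta :: 'm  (\<open>\<eta>\<close>)
    and eps :: 'm  (\<open>\<epsilon>\<close>)
  assumes "Qge0_linear_symmetric_monoidal_category C"
    and "\<And>n. A n \<in> Obj C"
    and "\<And>n p. \<nabla> n p \<in> Hom C (A n \<otimes>\<^sub>o A p) (A (n + p))"
    and "\<And>n p. \<Delta> n p \<in> Hom C (A (n + p)) (A n \<otimes>\<^sub>o A p)"
    and "\<eta> \<in> Hom C \<I> (A 0)"
    and "\<epsilon> \<in> Hom C (A 0) \<I>"
  shows "binomial_bimonoid C A \<nabla> \<Delta> \<eta> \<epsilon> \<longleftrightarrow>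
    (\<forall>n. \<eta> \<otimes>\<^sub>m \<i>\<d> (A n) ;; \<nabla> 0 n = \<i>\<d> (A n)) \<and>
    (\<forall>n. \<i>\<d> (A n) \<otimes>\<^sub>m \<eta> ;; \<nabla> n 0 = \<i>\<d> (A n)) \<and>
    (\<forall>n. \<Delta> 0 n ;; \<epsilon> \<otimes>\<^sub>m \<i>\<d> (A n) = \<i>\<d> (A n)) \<and>
    (\<forall>n. \<Delta> n 0 ;; \<i>\<d> (A n) \<otimes>\<^sub>m \<epsilon> = \<i>\<d> (A n)) \<and>
    (\<forall>n p q r. n + p = q + r \<longrightarrow>
      \<nabla> n p ;; \<Delta> q r =
        finprod (hom_monoid C (A n \<otimes>\<^sub>o A p) (A q \<otimes>\<^sub>o A r))
          (\<lambda>(a, b, c, d). \<Delta> a b \<otimes>\<^sub>m \<Delta> c d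
            ;; \<i>\<d> (A a) \<otimes>\<^sub>m \<gamma> (A b) (A c) \<otimes>\<^sub>m \<i>\<d> (A d)
            ;; \<nabla> a c \<otimes>\<^sub>m \<nabla> b d)
          {(a, b, c, d). a + b = n \<and> c + d = p \<and> a + c = q \<and> b + d = r}) \<and>
    \<eta> ;; \<epsilon> = \<i>\<d> \<I> \<and>
    (\<forall>n p. \<Delta> n p ;; \<nabla> n p = of_nat ((n + p) choose n) *\<^sub>m \<i>\<d> (A (n + p))) \<and>
    \<epsilon> ;; \<eta> = \<i>\<d> (A 0)"
  (is "_ \<longleftrightarrow> ?laws")
proof -
  have "binomial_bimonoid C A \<nabla> \<Delta> \<eta> \<epsilon> \<longleftrightarrow> binomial_laws C A \<nabla> \<Delta> \<eta> \<epsilon>"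
    by (rule iffI[OF binomial_bimonoid.laws binomial_laws.binomial_bimonoid])
  also have "\<dots> \<longleftrightarrow> ?laws"
    \<comment> \<open>The locale predicate unfolds to the typing conditions, which are the
      hypotheses, and the eight laws.\<close>
    using assms by (auto simp only: binomial_laws_def binomial_laws_axioms_def)
  finally show ?thesis .
qed

end
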